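(* Let $(\alpha_n,\beta_n)_{n\in\mathbb{Z}}$ be a bilateral Bailey pair relative to $a$, let $N\geq0$ be an integer and $\rho,\sigma$ complex parameters. Define for $n\in\mathbb{Z}$ \[ \alpha'_n=(1-aq^{2n-N})(aq^{1-N})_N\sum_{j=0}^N(-1)^j\frac{q^{N(n-j)+j(j-1)/2}}{(aq^{2n-N-j})_{N+1}}\begin{bmatrix}N\\ j\end{bmatrix}\frac{(\rho,\sigma)_{n-j}(aq/\rho\sigma)^{n-j}}{(aq/\rho,aq/\sigma)_{n-j}}\alpha_{n-j}, \] \[ \beta'_n=q^{nN}\sum_{j\le n}\frac{(\rho,\sigma)_j(aq/\rho\sigma)_{n-j}(aq/\rho\sigma)^j}{(q)_{n-j}(aq/\rho,aq/\sigma)_n}\beta_j . \] Then, subject to convergence conditions on $\alpha_n,\beta_n$ making all the relevant infinite series absolutely convergent, $(\alpha'_n,\beta'_n)$ is a bilateral Bailey pair relative to $aq^{-N}$.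
   Context: Fix complex numbers $a,q$ with $|q|<1$ (parameters generic so that no denominator vanishes). For complex $x$, $(x)_\infty=\prod_{j\ge0}(1-xq^j)$ and for $k\in\mathbb{Z}$, $(x)_k=(x)_\infty/(xq^k)_\infty$ (so $1/(q)_k=0$ for $k<0$); $(x_1,\dots,x_m)_k=(x_1)_k\cdots(x_m)_k$. A bilateral Bailey pair relative to $c$ is a pair of sequences $(\alpha_n)_{n\in\mathbb{Z}},(\beta_n)_{n\in\mathbb{Z}}$ such that for every $n\in\mathbb{Z}$, $\beta_n=\sum_{j\le n}\frac{\alpha_j}{(q)_{n-j}(cq)_{n+j}}$ (the series being convergent). For integers $N\ge0$ and $j$, $\begin{bmatrix}N\\ j\end{bmatrix}=\frac{(q)_N}{(q)_j(q)_{N-j}}$ if $0\le j\le N$ and $0$ otherwise. *)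

theory Defs
  imports "HOL-Analysis.Analysis"
begin

definition qpoch_inf :: "complex \<Rightarrow> complex \<Rightarrow> complex" where
  "qpoch_inf q x = (\<Prod>j. 1 - x * q ^ j)"

text \<open>
  The quotient is meaningful only if its denominator is nonzero. In \<open>(q)\<^sub>k\<close> with \<open>k < 0\<close> the
  denominator vanishes; division by zero then gives \<open>1/(q)\<^sub>k = 0\<close>, as the usual convention demands.
\<close>
definition qpoch :: "complex \<Rightarrow> complex \<Rightarrow> int \<Rightarrow> complex" where
  "qpoch q x k = qpoch_inf q x / qpoch_inf q (x * q powi k)"

definition qpochs :: "complex \<Rightarrow> complex list \<Rightarrow> int \<Rightarrow> complex" where
  "qpochs q xs k = (\<Prod>x\<leftarrow>xs. qpoch q x k)"

definition qbinom :: "complex \<Rightarrow> nat \<Rightarrow> int \<Rightarrow> complex" where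
  "qbinom q N j =
     (if 0 \<le> j \<and> j \<le> int N then qpoch q q (int N) / (qpoch q q j * qpoch q q (int N - j)) else 0)"

text \<open>
  Series over all integers \<open>j \<le> n\<close>, summed in the order \<open>j = n, n - 1, n - 2, \<dots>\<close>.
\<close>
definition sums_upto :: "(int \<Rightarrow> complex) \<Rightarrow> int \<Rightarrow> complex \<Rightarrow> bool" where
  "sums_upto f n s \<longleftrightarrow> (\<lambda>i. f (n - int i)) sums s"

definition suminf_upto :: "(int \<Rightarrow> complex) \<Rightarrow> int \<Rightarrow> complex" where
  "suminf_upto f n = (\<Sum>i. f (n - int i))"

definition bailey_term :: "complex \<Rightarrow> complex \<Rightarrow> (int \<Rightarrow> complex) \<Rightarrow> int \<Rightarrow> int \<Rightarrow> complex" where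
  "bailey_term q c \<alpha> n j = \<alpha> j / (qpoch q q (n - j) * qpoch q (c * q) (n + j))"

definition bilateral_bailey_pair ::
    "complex \<Rightarrow> complex \<Rightarrow> (int \<Rightarrow> complex) \<Rightarrow> (int \<Rightarrow> complex) \<Rightarrow> bool" where
  "bilateral_bailey_pair q c \<alpha> \<beta> \<longleftrightarrow> (\<forall>n. sums_upto (bailey_term q c \<alpha> n) n (\<beta> n))"

definition alpha' ::
    "complex \<Rightarrow> complex \<Rightarrow> nat \<Rightarrow> complex \<Rightarrow> complex \<Rightarrow> (int \<Rightarrow> complex) \<Rightarrow> int \<Rightarrow> complex" where
  "alpha' q a N \<rho> \<sigma> \<alpha> n =
     (1 - a * q powi (2 * n - int N)) * qpoch q (a * q powi (1 - int N)) (int N) *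
     (\<Sum>j=0..N. (-1) ^ j *
        (q powi (int N * (n - int j) + int (j * (j - 1) div 2))
           / qpoch q (a * q powi (2 * n - int N - int j)) (int N + 1)) *
        qbinom q N (int j) *
        (qpochs q [\<rho>, \<sigma>] (n - int j) * (a * q / (\<rho> * \<sigma>)) powi (n - int j)
           / qpochs q [a * q / \<rho>, a * q / \<sigma>] (n - int j)) *
        \<alpha> (n - int j))"

definition beta'_coeff ::
    "complex \<Rightarrow> complex \<Rightarrow> complex \<Rightarrow> complex \<Rightarrow> int \<Rightarrow> int \<Rightarrow> complex" where
  "beta'_coeff q a \<rho> \<sigma> n j =
     qpochs q [\<rho>, \<sigma>] j * qpoch q (a * q / (\<rho> * \<sigma>)) (n - j) * (a * q / (\<rho> * \<sigma>)) powi j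
       / (qpoch q q (n - j) * qpochs q [a * q / \<rho>, a * q / \<sigma>] n)"

definition beta' ::
    "complex \<Rightarrow> complex \<Rightarrow> nat \<Rightarrow> complex \<Rightarrow> complex \<Rightarrow> (int \<Rightarrow> complex) \<Rightarrow> int \<Rightarrow> complex" where
  "beta' q a N \<rho> \<sigma> \<beta> n =
     q powi (n * int N) * suminf_upto (\<lambda>j. beta'_coeff q a \<rho> \<sigma> n j * \<beta> j) n"

end

theory Submission
  imports Defs
begin

text \<open>
  Interchanging the two summations in \<open>\<beta>'\<^sub>n\<close> and evaluating the inner finite sum by the
  \<open>q\<close>-Pfaff-Saalschuetz formula gives the case \<open>N = 0\<close>: the sequence \<open>\<alpha>\<close> twisted by
  \<open>(\<rho>,\<sigma>)\<^sub>n (aq/\<rho>\<sigma>)\<^sup>n / (aq/\<rho>,aq/\<sigma>)\<^sub>n\<close> forms a pair relative to \<open>a\<close>. From there one descends from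
  \<open>c = aq\<^sup>-\<^sup>N\<close> to \<open>c/q\<close> one step at a time: the summand of the new series is \<open>q\<^sup>n\<close> times the old
  one plus a telescoping difference, so \<open>\<beta>\<^sub>n\<close> is multiplied by \<open>q\<^sup>n\<close>. By the two Pascal rules for
  \<open>q\<close>-binomials, the \<open>N\<close>-fold iterate of this step is the sequence \<open>\<alpha>'\<close>.
\<close>

section \<open>Infinite and finite q-shifted factorials, generic arguments\<close>

locale q_base =
  fixes q :: complex
  assumes norm_q: "norm q < 1" and q_nonzero: "q \<noteq> 0"
begin

text \<open>The product form of (x)_n for n \<ge> 0. Unlike the quotient \<open>qpoch\<close> it
  keeps the right value where infinite products vanish, so polynomial identities can be stated
  without side conditions.\<close>

definition qfin :: "complex \<Rightarrow> nat \<Rightarrow> complex" where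
  "qfin x n = (\<Prod>k<n. 1 - x * q ^ k)"

text \<open>Both infinite products in \<open>qpoch q x k\<close> are then nonzero for every integer
  k, so (x)_k is neither zero nor a division by zero.\<close>

definition generic :: "complex \<Rightarrow> bool" where
  "generic x \<longleftrightarrow> (\<forall>k::int. x \<noteq> q powi k)"

lemma generic_mult_powi: "generic (x * q powi k)" if "generic x"
proof -
  have "x = q powi (l - k)" if "x * q powi k = q powi l" for l
    using that q_nonzero by (simp add: power_int_diff field_simps)
  with that show ?thesis
    unfolding generic_def by blast
qed

lemma generic_ne_1: "x \<noteq> 1" if "generic x"
  using that[unfolded generic_def, rule_format, of 0] by simp

lemma generic_powi_ne_1: "x * q powi k \<noteq> 1" if "generic x"
  using generic_ne_1[OF generic_mult_powi[OF that]] .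

lemma q_powi_ne_1: "q powi k \<noteq> 1" if "k > 0"
proof -
  from that have "norm q powi k < 1"
    using norm_q q_nonzero power_int_strict_decreasing[of 0 k "norm q"] by simp
  then show ?thesis
    by (metis less_irrefl norm_one norm_power_int)
qed

lemma convergent_prod_qpoch: "convergent_prod (\<lambda>j. 1 - x * q ^ j)"
proof -
  have "summable (\<lambda>j. norm x * norm q ^ j)"
    using norm_q by (intro summable_mult summable_geometric) auto
  then have "abs_convergent_prod (\<lambda>j. 1 - x * q ^ j)"
    by (simp add: abs_convergent_prod_conv_summable norm_mult norm_power)
  then show ?thesis
    by (rule abs_convergent_prod_imp_convergent_prod)
qed

lemma qpoch_inf_nonzero: "qpoch_inf q x \<noteq> 0" if "\<And>m::nat. x * q ^ m \<noteq> 1"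
  unfolding qpoch_inf_def
  using that by (intro prodinf_nonzero convergent_prod_qpoch) (metis eq_iff_diff_eq_0)

lemma qpoch_inf_rec: "qpoch_inf q x = (1 - x) * qpoch_inf q (x * q)"
proof -
  have 1: "(\<lambda>n. \<Prod>j\<le>n. 1 - x * q ^ j) \<longlonglongrightarrow> qpoch_inf q x"
    by (metis convergent_prod_LIMSEQ convergent_prod_qpoch qpoch_inf_def)
  have "(\<lambda>n. \<Prod>j\<le>n. 1 - x * q * q ^ j) \<longlonglongrightarrow> qpoch_inf q (x * q)"
    by (metis convergent_prod_LIMSEQ convergent_prod_qpoch qpoch_inf_def)
  then have 2: "(\<lambda>n. (1 - x) * (\<Prod>j\<le>n. 1 - x * q * q ^ j)) \<longlonglongrightarrow> (1 - x) * qpoch_inf q (x * q)"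
    by (rule tendsto_mult_left)
  have "(\<lambda>n. \<Prod>j\<le>Suc n. 1 - x * q ^ j) = (\<lambda>n. (1 - x) * (\<Prod>j\<le>n. 1 - x * q * q ^ j))"
    by (subst prod.atMost_Suc_shift) (simp add: mult.assoc)
  with 2 LIMSEQ_Suc[OF 1] show ?thesis
    using LIMSEQ_unique by metis
qed

lemma qfin_0 [simp]: "qfin x 0 = 1"
  by (simp add: qfin_def)

lemma qfin_Suc: "qfin x (Suc n) = qfin x n * (1 - x * q ^ n)"
  by (simp add: qfin_def)

lemma qfin_Suc_shift: "qfin x (Suc n) = (1 - x) * qfin (x * q) n"
  unfolding qfin_def by (subst prod.lessThan_Suc_shift) (simp add: mult.assoc)

lemma qpoch_inf_split: "qpoch_inf q x = qfin x n * qpoch_inf q (x * q ^ n)"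
proof (induction n)
  case (Suc n)
  then show ?case
    using qpoch_inf_rec[of "x * q ^ n"] by (simp add: qfin_Suc mult_ac)
qed simp

text \<open>Excluding only x q^m = 1 with m \<ge> 0 lets this apply to x = q, which is not generic,
  and to x = aq/(\<rho>\<sigma>), of which less is assumed.\<close>

lemma qpoch_eq_qfin: "qpoch q x (int n) = qfin x n" if "\<And>m::nat. x * q ^ m \<noteq> 1"
proof -
  have "qpoch_inf q (x * q ^ n) \<noteq> 0"
    using that by (intro qpoch_inf_nonzero) (metis mult.assoc power_add)
  then show ?thesis
    using qpoch_inf_split[of x n] by (simp add: qpoch_def)
qed

lemma generic_power_ne_1: "x * q ^ m \<noteq> 1" if "generic x" for m :: nat
  using generic_powi_ne_1[OF that, of "int m"] by simp

lemma qpoch_inf_generic_nonzero: "qpoch_inf q x \<noteq> 0" if "generic x"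
  using that by (intro qpoch_inf_nonzero generic_power_ne_1)

lemma qpoch_generic_nonzero: "qpoch q x k \<noteq> 0" if "generic x"
  using qpoch_inf_generic_nonzero[OF that] qpoch_inf_generic_nonzero[OF generic_mult_powi[OF that]]
  by (simp add: qpoch_def)

lemma qpoch_add: "qpoch q x (k + l) = qpoch q x k * qpoch q (x * q powi k) l" if "generic x"
  using qpoch_inf_generic_nonzero[OF generic_mult_powi[OF that, of k]] q_nonzero
  by (simp add: qpoch_def power_int_add mult.assoc)

lemma qpoch_1: "qpoch q x 1 = 1 - x" if "generic x"
  using qpoch_eq_qfin[of x 1] generic_power_ne_1[OF that] by (simp add: qfin_Suc)

lemma qpoch_add_1: "qpoch q x (k + 1) = qpoch q x k * (1 - x * q powi k)" if "generic x"
  using qpoch_add[OF that, of k 1] qpoch_1[OF generic_mult_powi[OF that]] by simp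

lemma qpoch_add_1_shift: "qpoch q x (k + 1) = (1 - x) * qpoch q (x * q) k" if "generic x"
  using qpoch_add[OF that, of 1 k] qpoch_1[OF that] by (simp add: add.commute)

section \<open>Reciprocal factorials and q-binomial coefficients\<close>

definition rfact :: "int \<Rightarrow> complex" where
  "rfact k = 1 / qpoch q q k"

lemma q_power_ne_1: "q * q ^ m \<noteq> 1"
  using q_powi_ne_1[of "int (Suc m)"] by (simp add: power_int_def nat_add_distrib)

lemma qfin_q_nonzero: "qfin q n \<noteq> 0"
  unfolding qfin_def using q_power_ne_1 by (simp add: eq_commute[of 1])

text \<open>\<open>rfact k\<close> is the quotient of the infinite products of q^(k+1) and of q,
  even when the former is 0. Splitting the first factor off the infinite product of q^k therefore
  works for every integer k.\<close>

lemma rfact_rec: "rfact (k - 1) = (1 - q powi k) * rfact k"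
proof -
  have "q * q powi (k - 1) = q powi k"
    using q_nonzero by (simp add: power_int_diff)
  then show ?thesis
    using qpoch_inf_rec[of "q powi k"] by (simp add: rfact_def qpoch_def mult_ac)
qed

lemma rfact_nat: "rfact (int n) = 1 / qfin q n"
  by (simp add: rfact_def qpoch_eq_qfin q_power_ne_1)

lemma rfact_0 [simp]: "rfact 0 = 1"
  using rfact_nat[of 0] by simp

text \<open>The factor 1 - q^0 gives the zero at k = -1, and the recursion carries it
  downwards.\<close>

lemma rfact_neg: "rfact k = 0" if "k < 0"
proof -
  have "rfact (- int (Suc n)) = 0" for n
  proof (induction n)
    case 0
    show ?case using rfact_rec[of 0] by simp
  next
    case (Suc n)
    show ?case using rfact_rec[of "- int (Suc n)"] Suc by (simp add: algebra_simps)
  qed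
  from this[of "nat (- k - 1)"] that show ?thesis by simp
qed

lemma qbinom_rfact: "qbinom q N j = qfin q N * rfact j * rfact (int N - j)"
  by (auto simp: qbinom_def qpoch_eq_qfin q_power_ne_1 rfact_neg) (simp add: rfact_def)

text \<open>All three coefficients are multiples of one \<open>?c\<close>. With A = q^j and B =
  q^(N+1-j) the rules become 1 - AB = A(1 - B) + (1 - A) and 1 - AB = (1 - B) + B(1 - A).\<close>

lemma qbinom_pascal:
  "qbinom q (Suc N) j = q powi j * qbinom q N j + qbinom q N (j - 1)"
  "qbinom q (Suc N) j = qbinom q N j + q powi (int N + 1 - j) * qbinom q N (j - 1)"
proof -
  let ?c = "qfin q N * rfact j * rfact (int N + 1 - j)"
  have 1: "qbinom q (Suc N) j = (1 - q ^ Suc N) * ?c"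
    by (simp add: qbinom_rfact qfin_Suc algebra_simps)
  have 2: "qbinom q N j = (1 - q powi (int N + 1 - j)) * ?c"
    using rfact_rec[of "int N + 1 - j"] by (simp add: qbinom_rfact)
  have 3: "qbinom q N (j - 1) = (1 - q powi j) * ?c"
    using rfact_rec[of j] by (simp add: qbinom_rfact diff_diff_eq2 add.commute)
  have 4: "q powi j * q powi (int N + 1 - j) = q ^ Suc N"
    using q_nonzero power_int_add[of q j "int N + 1 - j"] by (simp add: power_int_def nat_add_distrib)
  show "qbinom q (Suc N) j = q powi j * qbinom q N j + qbinom q N (j - 1)"
    unfolding 1 2 3 4[symmetric] by (simp add: algebra_simps)
  show "qbinom q (Suc N) j = qbinom q N j + q powi (int N + 1 - j) * qbinom q N (j - 1)"
    unfolding 1 2 3 4[symmetric] by (simp add: algebra_simps)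
qed

lemma qbinom_self [simp]: "qbinom q N (int N) = 1" and qbinom_0 [simp]: "qbinom q N 0 = 1"
  using qfin_q_nonzero[of N] by (simp_all add: qbinom_rfact rfact_nat)

section \<open>The q-Pfaff-Saalschuetz sum\<close>

text \<open>
  The step from \<open>M\<close> to \<open>M + 1\<close> replaces \<open>z\<close> by \<open>zq\<close>; the difference of the two summands telescopes.
\<close>
lemma q_pfaff_saalschuetz_telescope:
  fixes x y z :: complex
  assumes "k \<le> M"
  defines "u \<equiv> \<lambda>i. qfin x i * qfin y i * z ^ i * qfin (z * q) (M - i) * qfin (x * y * z * q ^ Suc i) (M - i)"
  shows "(\<Sum>i\<le>k. (qbinom q (Suc M) (int i) * (1 - z) * (1 - x * y * z * q ^ i)
            - qbinom q M (int i) * q ^ i * (1 - x * z) * (1 - y * z)) * u i)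
         = - qbinom q M (int k) * z * (1 - x * q ^ k) * (1 - y * q ^ k) * u k"
  using assms(1)
proof (induction k)
  case 0
  show ?case by (simp add: algebra_simps)
next
  case (Suc k)
  define B where "B = qbinom q M (int (Suc k))"
  define C where "C = qbinom q M (int k)"
  define Q where "Q = q ^ Suc k"
  define R where "R = q ^ (M - k)"
  have P1: "qbinom q (Suc M) (int (Suc k)) = Q * B + C"
    using qbinom_pascal(1)[of M "int (Suc k)"] by (simp add: B_def C_def Q_def power_int_def nat_add_distrib)
  have "q powi (int M + 1 - int (Suc k)) = R"
    using Suc.prems by (simp add: R_def power_int_def nat_diff_distrib)
  then have P2: "qbinom q (Suc M) (int (Suc k)) = B + R * C"
    using qbinom_pascal(2)[of M "int (Suc k)"] by (simp add: B_def C_def)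
  obtain d where d: "M = Suc k + d"
    using Suc.prems le_Suc_ex by blast
  have u: "z * (1 - x * q ^ k) * (1 - y * q ^ k) * u k = u (Suc k) * (1 - z * R) * (1 - x * y * z * Q)"
  proof -
    have "qfin (z * q) (M - k) = qfin (z * q) d * (1 - z * R)"
      by (simp add: d R_def qfin_Suc Suc_diff_le mult_ac)
    moreover have "qfin (x * y * z * Q) (M - k) = (1 - x * y * z * Q) * qfin (x * y * z * q ^ Suc (Suc k)) d"
      by (simp add: d Q_def qfin_Suc_shift Suc_diff_le mult_ac)
    moreover have "M - Suc k = d"
      by (simp add: d)
    ultimately show ?thesis
      by (simp add: u_def qfin_Suc Q_def[symmetric] del: power_Suc) (simp add: mult_ac)
  qed
  \<comment> \<open>Equating the two Pascal rules gives the only relation between the binomials that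
    the polynomial identity \<open>main\<close> requires.\<close>
  have RC: "Q * B + C = B + R * C"
    using P1 P2 by simp
  have main: "(Q * B + C) * (1 - z) * (1 - x * y * z * Q) - B * Q * (1 - x * z) * (1 - y * z)
        - C * (1 - z * R) * (1 - x * y * z * Q) = - B * z * (1 - x * Q) * (1 - y * Q)"
    using RC by algebra
  have "(\<Sum>i\<le>Suc k. (qbinom q (Suc M) (int i) * (1 - z) * (1 - x * y * z * q ^ i)
            - qbinom q M (int i) * q ^ i * (1 - x * z) * (1 - y * z)) * u i)
      = - C * (z * (1 - x * q ^ k) * (1 - y * q ^ k) * u k)
        + ((Q * B + C) * (1 - z) * (1 - x * y * z * Q) - B * Q * (1 - x * z) * (1 - y * z)) * u (Suc k)"
    using Suc.IH Suc.prems P1 by (simp add: C_def B_def Q_def mult_ac)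
  also have "\<dots> = ((Q * B + C) * (1 - z) * (1 - x * y * z * Q) - B * Q * (1 - x * z) * (1 - y * z)
        - C * (1 - z * R) * (1 - x * y * z * Q)) * u (Suc k)"
    unfolding u by (simp add: algebra_simps)
  finally show ?case
    unfolding main unfolding B_def Q_def .
qed

text \<open>The balanced terminating 3phi2 sum with denominators cleared, hence valid for all x, y,
  z. The induction leaves z arbitrary because its hypothesis is used at zq.\<close>

lemma q_pfaff_saalschuetz:
  "(\<Sum>i\<le>M. qbinom q M (int i) * qfin x i * qfin y i * z ^ i * qfin z (M - i) * qfin (x * y * z * q ^ i) (M - i))
     = qfin (x * z) M * qfin (y * z) M"
proof (induction M arbitrary: z)
  case 0
  show ?case by simp
next
  case (Suc M)
  define u where "u i = qfin x i * qfin y i * z ^ i * qfin (z * q) (M - i) * qfin (x * y * z * q ^ Suc i) (M - i)" for i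
  have "qbinom q (Suc M) (int i) * qfin x i * qfin y i * z ^ i * qfin z (Suc M - i) * qfin (x * y * z * q ^ i) (Suc M - i)
      = qbinom q (Suc M) (int i) * (1 - z) * (1 - x * y * z * q ^ i) * u i" if "i \<le> M" for i
    using that by (simp add: Suc_diff_le qfin_Suc_shift u_def mult_ac)
  then have "(\<Sum>i\<le>M. qbinom q (Suc M) (int i) * qfin x i * qfin y i * z ^ i * qfin z (Suc M - i) * qfin (x * y * z * q ^ i) (Suc M - i))
     = (\<Sum>i\<le>M. qbinom q (Suc M) (int i) * (1 - z) * (1 - x * y * z * q ^ i) * u i)"
    by (intro sum.cong) auto
  then have 1: "(\<Sum>i\<le>Suc M. qbinom q (Suc M) (int i) * qfin x i * qfin y i * z ^ i * qfin z (Suc M - i) * qfin (x * y * z * q ^ i) (Suc M - i))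
     = (\<Sum>i\<le>M. qbinom q (Suc M) (int i) * (1 - z) * (1 - x * y * z * q ^ i) * u i)
       + qfin x (Suc M) * qfin y (Suc M) * z ^ Suc M"
    using qbinom_self[of "Suc M"] by simp
  have "qfin (x * z) (Suc M) * qfin (y * z) (Suc M) = (1 - x * z) * (1 - y * z) * (qfin (x * (z * q)) M * qfin (y * (z * q)) M)"
    by (simp add: qfin_Suc_shift mult_ac)
  also have "\<dots> = (\<Sum>i\<le>M. qbinom q M (int i) * q ^ i * (1 - x * z) * (1 - y * z) * u i)"
    unfolding Suc.IH[of "z * q", symmetric] sum_distrib_left
    by (intro sum.cong) (simp_all add: u_def power_mult_distrib mult_ac)
  finally have 2: "qfin (x * z) (Suc M) * qfin (y * z) (Suc M) = (\<Sum>i\<le>M. qbinom q M (int i) * q ^ i * (1 - x * z) * (1 - y * z) * u i)" .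
  \<comment> \<open>The boundary value of the telescoping sum is minus the term i =
    \<open>Suc M\<close> that was split off in \<open>1\<close>.\<close>
  have "(\<Sum>i\<le>M. (qbinom q (Suc M) (int i) * (1 - z) * (1 - x * y * z * q ^ i)
            - qbinom q M (int i) * q ^ i * (1 - x * z) * (1 - y * z)) * u i)
      = - qbinom q M (int M) * z * (1 - x * q ^ M) * (1 - y * q ^ M) * u M"
    unfolding u_def by (rule q_pfaff_saalschuetz_telescope) simp
  also have "\<dots> = - (qfin x (Suc M) * qfin y (Suc M) * z ^ Suc M)"
    by (simp add: u_def qfin_Suc mult_ac)
  finally have "(\<Sum>i\<le>M. qbinom q (Suc M) (int i) * (1 - z) * (1 - x * y * z * q ^ i) * u i)
      - (\<Sum>i\<le>M. qbinom q M (int i) * q ^ i * (1 - x * z) * (1 - y * z) * u i)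
      = - (qfin x (Suc M) * qfin y (Suc M) * z ^ Suc M)"
    by (simp only: left_diff_distrib[of _ _ "u _"] sum_subtractf)
  with 1 2 show ?case by (simp add: algebra_simps)
qed

section \<open>The case N = 0: interchanging the summations\<close>

lemma qfin_split: "i \<le> M \<Longrightarrow> qfin x M = qfin x i * qfin (x * q ^ i) (M - i)"
proof (induction M)
  case (Suc M)
  show ?case
  proof (cases "i = Suc M")
    case False
    with Suc show ?thesis
      by (simp add: Suc_diff_le qfin_Suc mult.assoc flip: power_add)
  qed simp
qed simp

lemma qpoch_add_nat: "qpoch q x (k + int i) = qpoch q x k * qfin (x * q powi k) i" if "generic x"
  using qpoch_add[OF that] qpoch_eq_qfin[OF generic_power_ne_1[OF generic_mult_powi[OF that]]] by simp

lemma qfin_generic_nonzero: "qfin x n \<noteq> 0" if "generic x"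
  using qpoch_eq_qfin[OF generic_power_ne_1[OF that]] qpoch_generic_nonzero[OF that] by metis

definition twist :: "complex \<Rightarrow> complex \<Rightarrow> complex \<Rightarrow> int \<Rightarrow> complex" where
  "twist a \<rho> \<sigma> r = qpochs q [\<rho>, \<sigma>] r * (a * q / (\<rho> * \<sigma>)) powi r / qpochs q [a * q / \<rho>, a * q / \<sigma>] r"

text \<open>This is the coefficient of \<alpha>_r after the interchange. Putting j = r + i and M = n
  - r turns it into a multiple of the q-Pfaff-Saalschuetz sum with x = \<rho>q^r, y = \<sigma>q^r, z
  = aq/(\<rho>\<sigma>), so that xyz = aq^(2r+1).\<close>

lemma beta'_coeff_sum:
  assumes "\<rho> \<noteq> 0" "\<sigma> \<noteq> 0" "a \<noteq> 0" and ga: "generic a" and g\<rho>: "generic \<rho>" "generic (a * q / \<rho>)"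
    and g\<sigma>: "generic \<sigma>" "generic (a * q / \<sigma>)"
    and gz: "\<And>m::nat. a * q / (\<rho> * \<sigma>) \<noteq> q powi (- int m)"
    and "r \<le> n"
  shows "(\<Sum>j\<in>{r..n}. beta'_coeff q a \<rho> \<sigma> n j / (qpoch q q (j - r) * qpoch q (a * q) (j + r)))
         = twist a \<rho> \<sigma> r / (qpoch q q (n - r) * qpoch q (a * q) (n + r))"
proof -
  define M where "M = nat (n - r)"
  have n: "n = r + int M"
    using \<open>r \<le> n\<close> by (simp add: M_def)
  define z where "z = a * q / (\<rho> * \<sigma>)"
  define x where "x = \<rho> * q powi r"
  define y where "y = \<sigma> * q powi r"
  define w where "w = a * q * q powi (2 * r)"
  have w: "x * y * z = w"
  proof -
    have "q powi (2 * r) = q powi r * q powi r"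
      unfolding mult_2 using q_nonzero by (intro power_int_add) simp
    then show ?thesis
      using assms(1,2) by (simp add: x_def y_def z_def w_def)
  qed
  have xz: "x * z = a * q / \<sigma> * q powi r" and yz: "y * z = a * q / \<rho> * q powi r"
    using assms(1,2) by (simp_all add: x_def y_def z_def)
  have gaq: "generic (a * q)"
    using generic_mult_powi[OF ga, of 1] by simp
  have gw: "generic w"
    unfolding w_def by (rule generic_mult_powi[OF gaq])
  have z_ne: "z * q ^ m \<noteq> 1" for m
    using gz[of m] q_nonzero by (auto simp: z_def power_int_minus field_simps)
  have z0: "z \<noteq> 0"
    using assms(1-3) q_nonzero by (simp add: z_def)
  \<comment> \<open>\<open>K\<close> collects what does not depend on i. Its factors 1/(w)_M and
    1/(q)_M are common denominators: 1/(w)_i = (w q^i)_(M-i) / (w)_M, and (q)_M completes the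
    binomial coefficient.\<close>
  define K where "K = qpochs q [\<rho>, \<sigma>] r * z powi r /
    (qpochs q [a * q / \<rho>, a * q / \<sigma>] n * qpoch q (a * q) (2 * r) * qfin w M * qfin q M)"
  have "beta'_coeff q a \<rho> \<sigma> n (r + int i) / (qpoch q q (r + int i - r) * qpoch q (a * q) (r + int i + r))
      = K * (qbinom q M (int i) * qfin x i * qfin y i * z ^ i * qfin z (M - i) * qfin (x * y * z * q ^ i) (M - i))"
    if "i \<le> M" for i
  proof -
    have e1: "qpoch q (a * q) (r + int i + r) = qpoch q (a * q) (2 * r) * qfin w i"
      using qpoch_add_nat[OF gaq, of "2 * r" i] by (simp add: w_def algebra_simps)
    have e2: "qpochs q [\<rho>, \<sigma>] (r + int i) = qpochs q [\<rho>, \<sigma>] r * qfin x i * qfin y i"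
      using g\<rho> g\<sigma> by (simp add: qpochs_def qpoch_add_nat x_def y_def)
    have nd: "n - (r + int i) = int (M - i)"
      using that by (simp add: n)
    have e3: "qpoch q z (n - (r + int i)) = qfin z (M - i)"
      unfolding nd by (rule qpoch_eq_qfin[OF z_ne])
    have e4: "qpoch q q (n - (r + int i)) = qfin q (M - i)"
      unfolding nd by (rule qpoch_eq_qfin[OF q_power_ne_1])
    have e5: "qpoch q q (r + int i - r) = qfin q i"
      by (simp add: qpoch_eq_qfin[OF q_power_ne_1])
    have e6: "z powi (r + int i) = z powi r * z ^ i"
      using z0 by (simp add: power_int_add)
    have e7: "qfin w M = qfin w i * qfin (w * q ^ i) (M - i)"
      by (rule qfin_split[OF that])
    have e8: "qbinom q M (int i) = qfin q M / (qfin q i * qfin q (M - i))"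
      using that by (simp add: qbinom_rfact rfact_nat flip: of_nat_diff)
    have nz: "qfin w i \<noteq> 0" "qfin (w * q ^ i) (M - i) \<noteq> 0" "qfin q M \<noteq> 0"
      using qfin_generic_nonzero[OF gw] e7 qfin_q_nonzero by auto
    show ?thesis
      unfolding beta'_coeff_def z_def[symmetric] e1 e2 e3 e4 e5 e6 w K_def e7 e8
      using nz by (simp add: divide_simps)
  qed
  then have "(\<Sum>i\<le>M. beta'_coeff q a \<rho> \<sigma> n (r + int i) / (qpoch q q (r + int i - r) * qpoch q (a * q) (r + int i + r)))
      = K * (qfin (x * z) M * qfin (y * z) M)"
    unfolding q_pfaff_saalschuetz[symmetric] sum_distrib_left by (intro sum.cong) auto
  moreover have "(\<Sum>j\<in>{r..n}. beta'_coeff q a \<rho> \<sigma> n j / (qpoch q q (j - r) * qpoch q (a * q) (j + r)))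
      = (\<Sum>i\<le>M. beta'_coeff q a \<rho> \<sigma> n (r + int i) / (qpoch q q (r + int i - r) * qpoch q (a * q) (r + int i + r)))"
    by (rule sum.reindex_bij_witness[where i = "\<lambda>i. r + int i" and j = "\<lambda>j. nat (j - r)"]) (auto simp: n)
  moreover have "K * (qfin (x * z) M * qfin (y * z) M)
      = twist a \<rho> \<sigma> r / (qpoch q q (n - r) * qpoch q (a * q) (n + r))"
  proof -
    have e1: "qpoch q (a * q) (n + r) = qpoch q (a * q) (2 * r) * qfin w M"
      using qpoch_add_nat[OF gaq, of "2 * r" M] by (simp add: n w_def algebra_simps)
    \<comment> \<open>The product side of the summation formula is exactly what turns the index n of
      this denominator into r.\<close>
    have e2: "qpochs q [a * q / \<rho>, a * q / \<sigma>] n = qpochs q [a * q / \<rho>, a * q / \<sigma>] r * (qfin (x * z) M * qfin (y * z) M)"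
      using g\<rho> g\<sigma> unfolding xz yz n by (simp add: qpochs_def qpoch_add_nat)
    have e3: "qpoch q q (n - r) = qfin q M"
      by (simp add: n qpoch_eq_qfin[OF q_power_ne_1])
    have "qfin (x * z) M * qfin (y * z) M \<noteq> 0"
      unfolding xz yz by (intro no_zero_divisors qfin_generic_nonzero generic_mult_powi g\<rho> g\<sigma>)
    then show ?thesis
      unfolding K_def twist_def e1 e2 e3 z_def[symmetric] by (simp add: divide_simps)
  qed
  ultimately show ?thesis by simp
qed

lemma has_sum_atMost_int_iff:
  fixes f :: "int \<Rightarrow> complex"
  shows "(f has_sum s) {..n} \<longleftrightarrow> ((\<lambda>i. f (n - int i)) has_sum s) UNIV"
  by (rule has_sum_reindex_bij_witness[where i = "\<lambda>i. n - int i" and j = "\<lambda>j. nat (n - j)"]) auto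

text \<open>Rearrangements are carried out with unordered sums; this returns to the descending order
  in which Bailey pairs are defined.\<close>

lemma has_sum_imp_sums_upto: "(f has_sum s) {..n} \<Longrightarrow> sums_upto f n s"
  unfolding has_sum_atMost_int_iff sums_upto_def by (rule has_sum_imp_sums)

text \<open>Fubini on the region r \<le> j \<le> n: summing over r first yields the series defining
  \<beta>'_n without its power of q, and summing over j first yields the twisted Bailey sum.\<close>

lemma twisted_pair_has_sum:
  assumes "\<rho> \<noteq> 0" "\<sigma> \<noteq> 0" "a \<noteq> 0" and ga: "generic a" and g\<rho>: "generic \<rho>" "generic (a * q / \<rho>)"
    and g\<sigma>: "generic \<sigma>" "generic (a * q / \<sigma>)"
    and gz: "\<And>m::nat. a * q / (\<rho> * \<sigma>) \<noteq> q powi (- int m)"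
    and pair: "bilateral_bailey_pair q a \<alpha> \<beta>"
    and abs_conv: "(\<lambda>(j, r). norm (beta'_coeff q a \<rho> \<sigma> n j * bailey_term q a \<alpha> j r))
                     summable_on (SIGMA j:{..n}. {..j})"
  shows "(bailey_term q a (\<lambda>r. twist a \<rho> \<sigma> r * \<alpha> r) n has_sum
           suminf_upto (\<lambda>j. beta'_coeff q a \<rho> \<sigma> n j * \<beta> j) n) {..n}"
proof -
  define f where "f = (\<lambda>(j, r). beta'_coeff q a \<rho> \<sigma> n j * bailey_term q a \<alpha> j r)"
  have f_abs: "(\<lambda>p. norm (f p)) summable_on (SIGMA j:{..n}. {..j})"
    using abs_conv by (simp add: f_def case_prod_unfold)
  then have "f summable_on (SIGMA j:{..n}. {..j})"
    by (rule abs_summable_summable)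
  then obtain S where S: "(f has_sum S) (SIGMA j:{..n}. {..j})"
    by (auto simp: summable_on_def)
  have inner: "((\<lambda>r. f (j, r)) has_sum beta'_coeff q a \<rho> \<sigma> n j * \<beta> j) {..j}" if "j \<le> n" for j
  proof -
    have "(\<lambda>r. norm (f (j, r))) summable_on {..j}"
      using f_abs that unfolding Infinite_Sum.abs_summable_on_Sigma_iff by auto
    then obtain s where s: "((\<lambda>r. f (j, r)) has_sum s) {..j}"
      using abs_summable_summable[of "\<lambda>r. f (j, r)"] unfolding summable_on_def by blast
    \<comment> \<open>The Bailey pair supplies only an ordered sum; uniqueness of limits identifies
      it with the unordered one.\<close>
    have "(\<lambda>i. beta'_coeff q a \<rho> \<sigma> n j * bailey_term q a \<alpha> j (j - int i)) sums (beta'_coeff q a \<rho> \<sigma> n j * \<beta> j)"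
      using pair unfolding bilateral_bailey_pair_def sums_upto_def by (intro sums_mult) auto
    with has_sum_imp_sums_upto[OF s] have "s = beta'_coeff q a \<rho> \<sigma> n j * \<beta> j"
      unfolding sums_upto_def f_def using sums_unique2 by auto
    with s show ?thesis by simp
  qed
  have "((\<lambda>j. beta'_coeff q a \<rho> \<sigma> n j * \<beta> j) has_sum S) {..n}"
    by (rule has_sum_SigmaD[OF S]) (use inner in auto)
  from has_sum_imp_sums_upto[OF this]
  have S_eq: "suminf_upto (\<lambda>j. beta'_coeff q a \<rho> \<sigma> n j * \<beta> j) n = S"
    unfolding sums_upto_def suminf_upto_def by (rule sums_unique[symmetric])
  \<comment> \<open>In the other order j runs, for fixed r, over the finite set
    \<open>{r..n}\<close>, where \<open>beta'_coeff_sum\<close> applies.\<close>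
  have S': "((\<lambda>(r, j). f (j, r)) has_sum S) (SIGMA r:{..n}. {r..n})"
    using S by (subst (asm) has_sum_reindex_bij_witness[where i = "\<lambda>(r, j). (j, r)" and j = "\<lambda>(j, r). (r, j)"
          and h = "\<lambda>(r, j). f (j, r)" and T = "SIGMA r:{..n}. {r..n}"]) auto
  have "((\<lambda>j. (\<lambda>(r, j). f (j, r)) (r, j)) has_sum bailey_term q a (\<lambda>r. twist a \<rho> \<sigma> r * \<alpha> r) n r) {r..n}"
    if "r \<in> {..n}" for r
  proof -
    have "(\<Sum>j\<in>{r..n}. f (j, r))
        = \<alpha> r * (\<Sum>j\<in>{r..n}. beta'_coeff q a \<rho> \<sigma> n j / (qpoch q q (j - r) * qpoch q (a * q) (j + r)))"
      unfolding sum_distrib_left by (intro sum.cong) (auto simp: f_def bailey_term_def)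
    also have "\<dots> = bailey_term q a (\<lambda>r. twist a \<rho> \<sigma> r * \<alpha> r) n r"
      using that by (subst beta'_coeff_sum) (use assms(1-9) in \<open>auto simp: bailey_term_def\<close>)
    finally show ?thesis
      using has_sum_finite[of "{r..n}" "\<lambda>j. f (j, r)"] by simp
  qed
  from has_sum_SigmaD[OF S' this] show ?thesis
    unfolding S_eq .
qed

section \<open>One descent step from c to c/q\<close>

text \<open>If the Bailey series of \<alpha> relative to c converges absolutely to B_n, that of this
  sequence relative to c/q converges to q^n B_n.\<close>

definition lower :: "complex \<Rightarrow> (int \<Rightarrow> complex) \<Rightarrow> int \<Rightarrow> complex" where
  "lower c \<alpha> m = (1 - c) * (q powi m * \<alpha> m / (1 - c * q powi (2 * m))
      - q powi (m - 1) * \<alpha> (m - 1) / (1 - c * q powi (2 * m - 2)))"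

text \<open>With Q = q^n and t = q^(n-m) the factor equals Qt(1 - t)/(t^2 - cQ^2), which tends to 0
  with t because c and Q are nonzero. The bound makes the telescoping terms summable.\<close>

lemma lower_factor_bounded:
  assumes "generic c" "c \<noteq> 0"
  obtains K where "\<And>m. m \<le> n \<Longrightarrow> norm ((q powi m - q powi n) / (1 - c * q powi (2 * m))) \<le> K"
proof -
  define Q where "Q = q powi n"
  have Q0: "Q \<noteq> 0"
    using q_nonzero by (simp add: Q_def)
  define F where "F i = Q * q ^ i * (1 - q ^ i) / ((q ^ i)\<^sup>2 - c * Q\<^sup>2)" for i
  have "(\<lambda>i. q ^ i) \<longlonglongrightarrow> 0"
    using norm_q by (rule LIMSEQ_power_zero)
  then have "F \<longlonglongrightarrow> Q * 0 * (1 - 0) / (0\<^sup>2 - c * Q\<^sup>2)"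
    unfolding F_def using Q0 assms(2) norm_q by (intro tendsto_intros) auto
  then have "Bseq F"
    using convergentI convergent_imp_Bseq by blast
  then obtain K where K: "\<And>i. norm (F i) \<le> K"
    unfolding Bseq_def by blast
  have "norm ((q powi m - q powi n) / (1 - c * q powi (2 * m))) \<le> K" if "m \<le> n" for m
  proof -
    define i where "i = nat (n - m)"
    define t where "t = q ^ i"
    have t0: "t \<noteq> 0"
      using q_nonzero by (simp add: t_def)
    have "m = n - int i"
      using that by (simp add: i_def)
    then have qm: "q powi m = Q / t"
      using q_nonzero by (simp add: power_int_diff Q_def t_def)
    have q2m: "q powi (2 * m) = (q powi m)\<^sup>2"
      unfolding mult_2 power2_eq_square using q_nonzero by (intro power_int_add) simp
    have den: "1 - c * (Q / t)\<^sup>2 = (t\<^sup>2 - c * Q\<^sup>2) / t\<^sup>2"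
      using t0 by (simp add: power_divide diff_divide_distrib)
    have num: "(Q / t - Q) * t\<^sup>2 = Q * t * (1 - t)"
      using t0 by (simp add: power2_eq_square left_diff_distrib right_diff_distrib)
    have "(q powi m - q powi n) / (1 - c * q powi (2 * m)) = F i"
      unfolding q2m qm Q_def[symmetric] F_def t_def[symmetric] den
      by (simp only: divide_divide_eq_right num)
    with K show ?thesis by simp
  qed
  then show ?thesis by (rule that)
qed

text \<open>\<open>h\<close> is chosen so that adding \<open>h m\<close> to q^n times the old term
  gives the \<alpha>_m part of the new term, while subtracting \<open>h (m - 1)\<close> gives its
  \<alpha>_(m-1) part.\<close>

lemma bailey_term_lower:
  fixes \<alpha> :: "int \<Rightarrow> complex" and n :: int
  assumes "generic c"
  defines "h \<equiv> \<lambda>m. bailey_term q c \<alpha> n m * ((q powi m - q powi n) / (1 - c * q powi (2 * m)))"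
  shows "bailey_term q (c / q) (lower c \<alpha>) n m = q powi n * bailey_term q c \<alpha> n m + h m - h (m - 1)"
proof -
  have gcq: "generic (c * q)"
    using generic_mult_powi[OF assms(1), of 1] by simp
  define P where "P = qpoch q (c * q) (n + m - 1)"
  define d where "d = 1 - c * q powi (2 * m)"
  define e where "e = 1 - c * q powi (2 * m - 2)"
  define s where "s = rfact (n - m)"
  have d0: "d \<noteq> 0" and c1: "c \<noteq> 1"
    using generic_powi_ne_1[OF assms(1)] generic_ne_1[OF assms(1)] by (simp_all add: d_def)
  have cq: "c / q * q = c"
    using q_nonzero by simp
  have p1: "qpoch q c (n + m) = (1 - c) * P"
    using qpoch_add_1_shift[OF assms(1), of "n + m - 1"] by (simp add: P_def)
  have shift: "c * q * q powi (n + m - 1) = c * q powi (n + m)"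
    using q_nonzero by (simp add: power_int_diff)
  have p2: "qpoch q (c * q) (n + m) = P * (1 - c * q powi (n + m))"
    using qpoch_add_1[OF gcq, of "n + m - 1"] unfolding shift P_def by simp
  have f0: "1 - c * q powi (n + m) \<noteq> 0"
    using generic_powi_ne_1[OF assms(1)] by simp
  have b1: "bailey_term q (c / q) (lower c \<alpha>) n m = lower c \<alpha> m * s / ((1 - c) * P)"
    unfolding bailey_term_def cq p1 by (simp add: s_def rfact_def)
  have b2: "bailey_term q c \<alpha> n m = \<alpha> m * s / (P * (1 - c * q powi (n + m)))"
    unfolding bailey_term_def p2 by (simp add: s_def rfact_def)
  have r: "rfact (n - (m - 1)) * (1 - q powi (n - m + 1)) = s"
    using rfact_rec[of "n - m + 1"] by (simp add: s_def algebra_simps)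
  have b3: "bailey_term q c \<alpha> n (m - 1) = \<alpha> (m - 1) * rfact (n - (m - 1)) / P"
    unfolding bailey_term_def by (simp add: P_def rfact_def algebra_simps)
  \<comment> \<open>The second factor reduces (q)_(n-m+1) to (q)_(n-m), so both parts share the
    denominator of the new term.\<close>
  have qq: "q powi (m - 1) - q powi n = q powi (m - 1) * (1 - q powi (n - m + 1))"
    using q_nonzero power_int_add[of q "m - 1" "n - m + 1"] by (simp add: algebra_simps)
  have e: "1 - c * q powi (2 * (m - 1)) = e"
    by (simp add: e_def algebra_simps)
  have h2: "h (m - 1) = q powi (m - 1) * \<alpha> (m - 1) * s / (P * e)"
    unfolding h_def b3 qq e r[symmetric] by simp
  \<comment> \<open>The factor 1 - c q^(n+m) produced here is the last one of (cq)_(n+m) and cancels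
    against it.\<close>
  have "q powi n * d + (q powi m - q powi n) = q powi m * (1 - c * q powi (n + m))"
  proof -
    have "q powi (2 * m) = q powi m * q powi m"
      unfolding mult_2 using q_nonzero by (intro power_int_add) simp
    then show ?thesis
      using q_nonzero by (simp add: d_def power_int_add right_diff_distrib mult_ac)
  qed
  then have "q powi n + (q powi m - q powi n) / d = q powi m * (1 - c * q powi (n + m)) / d"
    using d0 by (simp add: field_simps)
  then have "q powi n * bailey_term q c \<alpha> n m + h m
      = q powi m * (1 - c * q powi (n + m)) / d * bailey_term q c \<alpha> n m"
    unfolding h_def d_def[symmetric] by (metis distrib_right mult.commute)
  also have "\<dots> = q powi m * \<alpha> m * s / (P * d)"
    unfolding b2 using f0 by (simp add: mult_ac)
  finally have h1: "q powi n * bailey_term q c \<alpha> n m + h m = q powi m * \<alpha> m * s / (P * d)" .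
  have cancel: "(1 - c) * D * s / ((1 - c) * P) = D * (s / P)" for D
    using c1 by simp
  show ?thesis
    unfolding h1 h2 b1 lower_def d_def[symmetric] e_def[symmetric] cancel
    unfolding left_diff_distrib by (simp add: mult_ac)
qed

lemma lower_has_sum:
  assumes "generic c" "c \<noteq> 0" and sum: "(bailey_term q c \<alpha> n has_sum B) {..n}"
  shows "(bailey_term q (c / q) (lower c \<alpha>) n has_sum q powi n * B) {..n}"
proof -
  define h where "h m = bailey_term q c \<alpha> n m * ((q powi m - q powi n) / (1 - c * q powi (2 * m)))" for m
  obtain K where K: "\<And>m. m \<le> n \<Longrightarrow> norm ((q powi m - q powi n) / (1 - c * q powi (2 * m))) \<le> K"
    using lower_factor_bounded[OF assms(1,2)] by blast
  have "(\<lambda>m. norm (bailey_term q c \<alpha> n m)) summable_on {..n}"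
    using sum summable_on_iff_abs_summable_on_complex by (auto simp: summable_on_def)
  then have "(\<lambda>m. norm (bailey_term q c \<alpha> n m) * K) summable_on {..n}"
    by (rule summable_on_cmult_left)
  then have "(\<lambda>m. norm (h m)) summable_on {..n}"
    by (rule Infinite_Sum.abs_summable_on_comparison_test')
       (use K in \<open>auto simp only: h_def norm_mult atMost_iff intro!: mult_left_mono norm_ge_zero\<close>)
  then obtain H where H: "(h has_sum H) {..n}"
    using abs_summable_summable by (auto simp: summable_on_def)
  \<comment> \<open>Hence the sums of \<open>h m\<close> and \<open>h (m - 1)\<close> over m \<le> n
    agree, and the telescoping part contributes nothing.\<close>
  have "h n = 0"
    by (simp add: h_def)
  with H have "(h has_sum H) {..n - 1}"
    by (subst has_sum_cong_neutral[where T = "{..n}" and g = h]) (auto simp: order_le_less)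
  then have H': "((\<lambda>m. h (m - 1)) has_sum H) {..n}"
    by (subst has_sum_reindex_bij_witness[where i = "\<lambda>m. m + 1" and j = "\<lambda>m. m - 1" and h = h and T = "{..n - 1}"]) auto
  have "((\<lambda>m. q powi n * bailey_term q c \<alpha> n m + h m + - h (m - 1)) has_sum q powi n * B + H + - H) {..n}"
    by (intro has_sum_add has_sum_cmult_right sum H) (use H' in \<open>simp add: has_sum_uminus\<close>)
  moreover have "bailey_term q (c / q) (lower c \<alpha>) n
      = (\<lambda>m. q powi n * bailey_term q c \<alpha> n m + h m + - h (m - 1))"
    unfolding h_def by (rule ext, subst bailey_term_lower[OF assms(1)]) (rule diff_conv_add_uminus)
  moreover have "q powi n * B + H + - H = q powi n * B"
    by simp
  ultimately show ?thesis
    by (simp only:)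
qed

section \<open>The N-fold iterate of the descent step\<close>

definition alpha'_coeff :: "complex \<Rightarrow> nat \<Rightarrow> int \<Rightarrow> nat \<Rightarrow> complex" where
  "alpha'_coeff a N n j = (-1) ^ j *
        (q powi (int N * (n - int j) + int (j * (j - 1) div 2))
           / qpoch q (a * q powi (2 * n - int N - int j)) (int N + 1)) * qbinom q N (int j)"

lemma alpha'_eq:
  "alpha' q a N \<rho> \<sigma> \<alpha> n = (1 - a * q powi (2 * n - int N)) * qpoch q (a * q powi (1 - int N)) (int N) *
     (\<Sum>j=0..N. alpha'_coeff a N n j * (twist a \<rho> \<sigma> (n - int j) * \<alpha> (n - int j)))"
  unfolding alpha'_def alpha'_coeff_def twist_def by (simp only: mult.assoc)

text \<open>The first Pascal rule minus w q^j times the second. The factors 1 - w and 1 - w q^(N+1)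
  are the outermost ones of (w)_(N+2).\<close>

lemma qbinom_pascal_linear:
  "qbinom q (Suc N) j * (1 - w * q powi j)
     = q powi j * qbinom q N j * (1 - w) + qbinom q N (j - 1) * (1 - w * q powi (int N + 1))"
proof -
  have 1: "q powi j * q powi (int N + 1 - j) = q powi (int N + 1)"
    using q_nonzero power_int_add[of q j "int N + 1 - j"] by simp
  have "qbinom q (Suc N) j * (1 - w * q powi j) = (q powi j * qbinom q N j + qbinom q N (j - 1))
      - w * q powi j * (qbinom q N j + q powi (int N + 1 - j) * qbinom q N (j - 1))"
    using qbinom_pascal[of N j] by (simp add: algebra_simps)
  then show ?thesis
    unfolding 1[symmetric] by (simp add: algebra_simps)
qed

text \<open>Dropping the first or the last factor of (w)_(N+2) gives the denominators of the two
  coefficients for N that meet in one coefficient for N + 1.\<close>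

lemma qpoch_window:
  assumes "generic w"
  shows "qpoch q (w * q) (int N + 1) = qpoch q w (int N + 2) / (1 - w)"
    and "qpoch q w (int N + 1) = qpoch q w (int N + 2) / (1 - w * q powi (int N + 1))"
proof -
  show "qpoch q (w * q) (int N + 1) = qpoch q w (int N + 2) / (1 - w)"
    using qpoch_add_1_shift[OF assms, of "int N + 1"] generic_ne_1[OF assms] by (simp add: add.assoc)
  show "qpoch q w (int N + 1) = qpoch q w (int N + 2) / (1 - w * q powi (int N + 1))"
    using qpoch_add_1[OF assms, of "int N + 1"] generic_powi_ne_1[OF assms, of "int N + 1"]
    by (simp add: add.assoc)
qed

text \<open>At j = 0 nothing comes from n - 1: the factor on the left is the first one of the
  denominator (w)_(N+2) and shortens it to (wq)_(N+1).\<close>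

lemma alpha'_coeff_0:
  assumes "generic a"
  shows "(1 - a * q powi (2 * n - int N - 1)) * alpha'_coeff a (Suc N) n 0 = q powi n * alpha'_coeff a N n 0"
proof -
  define w where "w = a * q powi (2 * n - int N - 1)"
  have gw: "generic w"
    unfolding w_def by (rule generic_mult_powi[OF assms])
  have wq: "a * q powi (2 * n - int N) = w * q"
    using q_nonzero by (simp add: w_def power_int_diff)
  have w': "a * q powi (2 * n - int (Suc N) - int 0) = w"
    by (simp add: w_def algebra_simps)
  have e: "q powi (int (Suc N) * n) = q powi n * q powi (int N * n)"
    using q_nonzero by (simp add: algebra_simps power_int_add)
  show ?thesis
    using qpoch_window(1)[OF gw, of N] generic_ne_1[OF gw]
    unfolding alpha'_coeff_def w' w_def[symmetric]
    by (simp add: wq e add.commute del: of_nat_Suc) (simp add: add_ac)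
qed

lemma triangle_Suc: "Suc j * (Suc j - 1) div 2 = j + j * (j - 1) div 2"
proof (cases j)
  case (Suc k)
  have "Suc j * (Suc j - 1) = j * (j - 1) + j * 2"
    by (simp add: Suc algebra_simps)
  then show ?thesis by simp
qed simp

text \<open>Over the common denominator (w)_(N+2), and after removing equal powers of q, this is
  \<open>qbinom_pascal_linear\<close> at j + 1.\<close>

lemma alpha'_coeff_Suc:
  assumes "generic a"
  shows "(1 - a * q powi (2 * n - int N - 1)) * alpha'_coeff a (Suc N) n (Suc j)
    = q powi n * alpha'_coeff a N n (Suc j) - q powi (n - 1) * alpha'_coeff a N (n - 1) j"
proof -
  define w where "w = a * q powi (2 * n - int N - 1 - int (Suc j))"
  define P where "P = qpoch q w (int N + 2)"
  define T where "T = q powi (int (Suc N) * (n - int (Suc j)) + int (Suc j * (Suc j - 1) div 2))"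
  have gw: "generic w"
    unfolding w_def by (rule generic_mult_powi[OF assms])
  have arg0: "a * q powi (2 * n - int N - 1) = w * q powi int (Suc j)"
    using q_nonzero unfolding w_def mult.assoc by (subst power_int_add[symmetric]) auto
  have arg1: "a * q powi (2 * n - int (Suc N) - int (Suc j)) = w"
    by (simp add: w_def algebra_simps)
  have arg2: "a * q powi (2 * n - int N - int (Suc j)) = w * q"
  proof -
    have "q powi (2 * n - int N - 1 - int (Suc j)) * q powi 1 = q powi (2 * n - int N - int (Suc j))"
      using q_nonzero by (subst power_int_add[symmetric]) (auto simp: algebra_simps)
    then show ?thesis by (simp add: w_def mult.assoc)
  qed
  have arg3: "a * q powi (2 * (n - 1) - int N - int j) = w"
    by (simp add: w_def algebra_simps)
  \<comment> \<open>Writing n = (n-j-1) + (j+1) leaves the surplus q^(j+1) demanded by the Pascal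
    rule; in \<open>ex2\<close> the surplus q^j is absorbed by the triangular exponent.\<close>
  have ex1: "q powi n * q powi (int N * (n - int (Suc j)) + int (Suc j * (Suc j - 1) div 2)) = q powi int (Suc j) * T"
    unfolding T_def using q_nonzero by (subst (1 2) power_int_add[symmetric]) (auto simp: algebra_simps)
  have ex2: "q powi (n - 1) * q powi (int N * (n - 1 - int j) + int (j * (j - 1) div 2)) = T"
    unfolding T_def triangle_Suc using q_nonzero
    by (subst power_int_add[symmetric]) (auto simp: algebra_simps)
  have c1: "alpha'_coeff a (Suc N) n (Suc j) = (-1) ^ Suc j * (T / P) * qbinom q (Suc N) (int (Suc j))"
    unfolding alpha'_coeff_def arg1 T_def P_def by (simp add: add_ac)
  have c2: "q powi n * alpha'_coeff a N n (Suc j)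
      = (-1) ^ Suc j * (q powi int (Suc j) * T / (P / (1 - w))) * qbinom q N (int (Suc j))"
    unfolding alpha'_coeff_def arg2 qpoch_window(1)[OF gw] ex1[symmetric] P_def by simp
  have c3: "q powi (n - 1) * alpha'_coeff a N (n - 1) j
      = (-1) ^ j * (T / (P / (1 - w * q powi (int N + 1)))) * qbinom q N (int (Suc j) - 1)"
    unfolding alpha'_coeff_def arg3 qpoch_window(2)[OF gw] ex2[symmetric] P_def by simp
  have "(1 - w * q powi int (Suc j)) * ((-1) ^ Suc j * (T / P) * qbinom q (Suc N) (int (Suc j)))
      = (-1) ^ Suc j * (T / P) * (qbinom q (Suc N) (int (Suc j)) * (1 - w * q powi int (Suc j)))"
    by (simp only: mult_ac)
  also have "\<dots> = (-1) ^ Suc j * (q powi int (Suc j) * T / (P / (1 - w))) * qbinom q N (int (Suc j))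
      - (-1) ^ j * (T / (P / (1 - w * q powi (int N + 1)))) * qbinom q N (int (Suc j) - 1)"
    unfolding qbinom_pascal_linear by (simp add: distrib_left mult_ac)
  finally show ?thesis
    unfolding c1 c2 c3 arg0 .
qed

lemma alpha'_0:
  assumes "generic a"
  shows "alpha' q a 0 \<rho> \<sigma> \<alpha> = (\<lambda>r. twist a \<rho> \<sigma> r * \<alpha> r)"
proof
  fix r
  have "qpoch q (a * q) 0 = 1"
    using qpoch_inf_generic_nonzero[OF generic_mult_powi[OF assms, of 1]] by (simp add: qpoch_def)
  then show "alpha' q a 0 \<rho> \<sigma> \<alpha> r = twist a \<rho> \<sigma> r * \<alpha> r"
    using generic_powi_ne_1[OF assms, of "2 * r"] qbinom_0[of 0]
    by (simp add: alpha'_eq alpha'_coeff_def qpoch_1[OF generic_mult_powi[OF assms]])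
qed

text \<open>Division by 1 - c q^(2m) removes the leading factor of \<alpha>'_m and leaves
  \<open>P * S m\<close>. Then \<open>lower\<close> becomes q^n S_n - q^(n-1) S_(n-1) up to a
  constant, and the coefficient recursions apply term by term.\<close>

lemma alpha'_Suc:
  assumes "generic a"
  shows "alpha' q a (Suc N) \<rho> \<sigma> \<alpha> = lower (a * q powi (- int N)) (alpha' q a N \<rho> \<sigma> \<alpha>)"
proof
  fix n
  define c where "c = a * q powi (- int N)"
  define A where "A r = twist a \<rho> \<sigma> r * \<alpha> r" for r
  define P where "P = qpoch q (a * q powi (1 - int N)) (int N)"
  define S where "S n = (\<Sum>j=0..N. alpha'_coeff a N n j * A (n - int j))" for n
  have gc: "generic c"
    unfolding c_def by (rule generic_mult_powi[OF assms])
  have c1: "c * q = a * q powi (1 - int N)" and c2: "a * q powi (1 - int (Suc N)) = c"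
    using q_nonzero by (simp_all add: c_def power_int_diff power_int_minus field_simps)
  have ck: "a * q powi (k - int N) = c * q powi k" for k
    using q_nonzero by (simp add: c_def power_int_diff power_int_minus field_simps)
  have P_Suc: "qpoch q (a * q powi (1 - int (Suc N))) (int (Suc N)) = (1 - c) * P"
    unfolding c2 P_def c1[symmetric] using qpoch_add_1_shift[OF gc, of "int N"] by (simp add: add.commute)
  have old: "alpha' q a N \<rho> \<sigma> \<alpha> m / (1 - c * q powi (2 * m)) = P * S m" for m
    unfolding alpha'_eq S_def P_def A_def ck using generic_powi_ne_1[OF gc, of "2 * m"] by simp
  have t0: "(1 - a * q powi (2 * n - int N - 1)) * (alpha'_coeff a (Suc N) n 0 * A (n - int 0))
      = q powi n * (alpha'_coeff a N n 0 * A (n - int 0))"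
    using alpha'_coeff_0[OF assms, of n N] by (simp only: mult.assoc[symmetric])
  have tS: "(1 - a * q powi (2 * n - int N - 1)) * (alpha'_coeff a (Suc N) n (Suc j) * A (n - int (Suc j)))
      = q powi n * (alpha'_coeff a N n (Suc j) * A (n - int (Suc j)))
        - q powi (n - 1) * (alpha'_coeff a N (n - 1) j * A (n - 1 - int j))" for j
  proof -
    have "n - 1 - int j = n - int (Suc j)"
      by simp
    then show ?thesis
      using alpha'_coeff_Suc[OF assms, of n N j] by (simp only: mult.assoc[symmetric] left_diff_distrib)
  qed
  have "(1 - a * q powi (2 * n - int N - 1)) * (\<Sum>j=0..Suc N. alpha'_coeff a (Suc N) n j * A (n - int j))
      = q powi n * (\<Sum>j=0..Suc N. alpha'_coeff a N n j * A (n - int j)) - q powi (n - 1) * S (n - 1)"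
    unfolding sum.atLeast0_atMost_Suc_shift S_def
    by (simp only: comp_def distrib_left sum_distrib_left t0 tS sum_subtractf add_diff_eq)
  \<comment> \<open>The range was padded by j = \<open>Suc N\<close>, where the binomial coefficient
    is 0.\<close>
  also have "(\<Sum>j=0..Suc N. alpha'_coeff a N n j * A (n - int j)) = S n"
  proof -
    have "alpha'_coeff a N n (Suc N) = 0"
      by (simp add: alpha'_coeff_def qbinom_def)
    then show ?thesis by (simp add: S_def)
  qed
  finally have sum_eq: "q powi n * S n - q powi (n - 1) * S (n - 1) = (1 - a * q powi (2 * n - int N - 1)) *
      (\<Sum>j=0..Suc N. alpha'_coeff a (Suc N) n j * A (n - int j))" ..
  have "2 * n - int (Suc N) = 2 * n - int N - 1"
    by simp
  then have "alpha' q a (Suc N) \<rho> \<sigma> \<alpha> n = (1 - c) * P * (q powi n * S n - q powi (n - 1) * S (n - 1))"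
    unfolding alpha'_eq P_Suc A_def[symmetric] sum_eq by (simp only: mult_ac)
  also have "\<dots> = lower c (alpha' q a N \<rho> \<sigma> \<alpha>) n"
  proof -
    have "2 * n - 2 = 2 * (n - 1)"
      by simp
    then show ?thesis
      unfolding lower_def times_divide_eq_right[symmetric] by (simp only: old) (simp add: algebra_simps)
  qed
  finally show "alpha' q a (Suc N) \<rho> \<sigma> \<alpha> n = lower (a * q powi (- int N)) (alpha' q a N \<rho> \<sigma> \<alpha>) n"
    unfolding c_def .
qed

lemma alpha'_has_sum:
  assumes "generic a" "a \<noteq> 0"
    and "(bailey_term q a (\<lambda>r. twist a \<rho> \<sigma> r * \<alpha> r) n has_sum B) {..n}"
  shows "(bailey_term q (a * q powi (- int N)) (alpha' q a N \<rho> \<sigma> \<alpha>) n has_sum q powi (n * int N) * B) {..n}"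
proof (induction N)
  case 0
  with assms show ?case by (simp add: alpha'_0)
next
  case (Suc N)
  have 1: "a * q powi (- int (Suc N)) = a * q powi (- int N) / q"
    using q_nonzero by (simp add: power_int_minus power_int_diff field_simps)
  have 2: "q powi (n * int (Suc N)) * B = q powi n * (q powi (n * int N) * B)"
    using q_nonzero by (simp add: algebra_simps power_int_add)
  show ?case
    unfolding 1 2 alpha'_Suc[OF assms(1)]
    using assms(2) q_nonzero by (intro lower_has_sum generic_mult_powi assms(1) Suc.IH) simp
qed

end

text \<open>\<open>abs_conv\<close> is absolute convergence of the double series over r \<le> j
  \<le> n; it justifies the interchange, and each descent step preserves absolute convergence. For
  aq/(\<rho>\<sigma>) only the powers q^(-m) with m \<ge> 0 are excluded, since its shifted
  factorial occurs with index n - j \<ge> 0.\<close>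

theorem theorem3p6:
  fixes q a \<rho> \<sigma> :: complex and N :: nat and \<alpha> \<beta> :: "int \<Rightarrow> complex"
  assumes q: "norm q < 1" "q \<noteq> 0"
    and nonzero: "a \<noteq> 0" "\<rho> \<noteq> 0" "\<sigma> \<noteq> 0"
    and generic_a: "\<And>k::int. a \<noteq> q powi k"
    and generic_\<rho>: "\<And>k::int. \<rho> \<noteq> q powi k" "\<And>k::int. a * q / \<rho> \<noteq> q powi k"
    and generic_\<sigma>: "\<And>k::int. \<sigma> \<noteq> q powi k" "\<And>k::int. a * q / \<sigma> \<noteq> q powi k"
    and generic_\<rho>\<sigma>: "\<And>m::nat. a * q / (\<rho> * \<sigma>) \<noteq> q powi (- int m)"
    and pair: "bilateral_bailey_pair q a \<alpha> \<beta>"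
    and abs_conv: "\<And>n::int. (\<lambda>(j, r). norm (beta'_coeff q a \<rho> \<sigma> n j * bailey_term q a \<alpha> j r))
                     summable_on (SIGMA j:{..n}. {..j})"
  shows "bilateral_bailey_pair q (a * q powi (- int N)) (alpha' q a N \<rho> \<sigma> \<alpha>) (beta' q a N \<rho> \<sigma> \<beta>)"
proof -
  interpret q_base q
    using q by unfold_locales
  have gen: "generic a" "generic \<rho>" "generic (a * q / \<rho>)" "generic \<sigma>" "generic (a * q / \<sigma>)"
    using generic_a generic_\<rho> generic_\<sigma> by (simp_all add: generic_def)
  show ?thesis
    unfolding bilateral_bailey_pair_def beta'_def
    by (intro allI has_sum_imp_sums_upto alpha'_has_sum twisted_pair_has_sum gen nonzero generic_\<rho>\<sigma> pair abs_conv)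
qed

end
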